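(* For every constant $c>0$, the family of polytopes $\mathrm{P}_{\mathrm{cycl}}^{\ell}(n)$, where $n$ and $\ell$ range over all positive integers with $\ell\le c\log n$, has compact extended formulations.
   Context: $K_n=([n],E_n)$ is the complete graph on $[n]=\{1,\dots,n\}$. $\mathcal{C}^{\ell}(n)$ is the set of all (edge sets of) simple cycles $C\subseteq E_n$ of length $|C|=\ell$ in $K_n$; $\chi(C)\in\{0,1\}^{E_n}$ is the characteristic vector of $C$; and $\mathrm{P}_{\mathrm{cycl}}^{\ell}(n)=\operatorname{conv}\{\chi(C): C\in\mathcal{C}^{\ell}(n)\}\subseteq\mathbb{R}^{E_n}$ (empty if $\ell<3$ or $\ell>n$). An extension of a polytope $P\subseteq\mathbb{R}^m$ is a polyhedron $Q\subseteq\mathbb{R}^d$ together with an affine map $p:\mathbb{R}^d\to\mathbb{R}^m$ with $p(Q)=P$. An extended formulation for $P$ is a finite system of linear equations and inequalities whose solution set, together with some such map $p$, is an extension of $P$. Its size is its number of inequalities (including nonnegativity constraints, but not equations). Extended formulations for a family of polytopes $P\subseteq\mathbb{R}^m$ (varying $m$) are compact if their sizes and the encoding lengths of the coefficients needed to describe them are bounded by a polynomial in $m$ and the maximal encoding length of the components of the vertices of $P$. No symmetry is required. *)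

theory Defs
  imports
    "HOL-Analysis.Analysis"
    "HOL-Analysis.Finite_Function_Topology"
    "HOL-Computational_Algebra.Polynomial"
begin

text \<open>
  For a finite index set \<open>I\<close>, the space \<open>\<real>\<^sup>I\<close> is rendered as the subspace of the real vector space
  \<open>'i \<Rightarrow>\<^sub>0 real\<close> consisting of the vectors whose support lies in \<open>I\<close>; \<open>\<real>\<^sup>d\<close> is the case
  \<open>I = {..<d}\<close>. This allows the dimension to vary inside a formula, while \<open>convex hull\<close> and
  \<open>extreme_point_of\<close> are the library notions.
\<close>

definition coord_space :: "'i set \<Rightarrow> ('i \<Rightarrow>\<^sub>0 real) set" where
  "coord_space I = {x. Poly_Mapping.keys x \<subseteq> I}"


section \<open>Cycle polytopes\<close>

definition complete_edges :: "nat \<Rightarrow> nat set set" where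
  "complete_edges n = {e. e \<subseteq> {1..n} \<and> card e = 2}"

definition simple_cycles :: "nat \<Rightarrow> nat \<Rightarrow> nat set set set" where
  "simple_cycles l n =
     {C. \<exists>vs. length vs = l \<and> 3 \<le> l \<and> distinct vs \<and> set vs \<subseteq> {1..n} \<and>
            C = {{vs ! i, vs ! (Suc i mod l)} | i. i < l}}"

definition char_vec :: "'i set \<Rightarrow> ('i \<Rightarrow>\<^sub>0 real)" where
  "char_vec C = (\<Sum>e\<in>C. Poly_Mapping.single e 1)"

lemma lookup_char_vec:
  assumes "finite C"
  shows "Poly_Mapping.lookup (char_vec C) e = (if e \<in> C then 1 else 0)"
  using assms by (simp add: char_vec_def lookup_sum lookup_single when_def)

definition cycle_polytope :: "nat \<Rightarrow> nat \<Rightarrow> (nat set \<Rightarrow>\<^sub>0 real) set" where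
  "cycle_polytope l n = convex hull (char_vec ` simple_cycles l n)"


section \<open>Encoding lengths\<close>

text \<open>For \<open>p / q\<close> in lowest terms with \<open>q > 0\<close>: one bit for the sign, plus the binary lengths
  \<open>\<lceil>log\<^sub>2 (\<bar>p\<bar> + 1)\<rceil>\<close> and \<open>\<lceil>log\<^sub>2 (q + 1)\<rceil>\<close>.\<close>

definition encoding_length :: "rat \<Rightarrow> nat" where
  "encoding_length r =
     (case quotient_of r of (p, q) \<Rightarrow>
        1 + nat \<lceil>log 2 (real_of_int (\<bar>p\<bar> + 1))\<rceil> + nat \<lceil>log 2 (real_of_int (q + 1))\<rceil>)"

text \<open>The maximal encoding length of a component of a vertex of \<open>P \<subseteq> \<real>\<^sup>I\<close>, for a polytope \<open>P\<close> with
  rational vertices. Inserting \<open>0\<close> only fixes the value when there is no such component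
  (\<open>P\<close> or \<open>I\<close> empty).\<close>

definition vertex_encoding_length :: "'i set \<Rightarrow> ('i \<Rightarrow>\<^sub>0 real) set \<Rightarrow> nat" where
  "vertex_encoding_length I P =
     Max (insert 0 {encoding_length r | r x i.
            x extreme_point_of P \<and> i \<in> I \<and> Poly_Mapping.lookup x i = of_rat r})"


section \<open>Extended formulations\<close>

text \<open>
  A rational extended formulation in variables \<open>y\<^sub>0, \<dots>, y\<^bsub>d-1\<^esub>\<close>, \<open>d = ef_dim F\<close>. A pair \<open>(a, b)\<close>
  stands for the equation \<open>\<Sum>j<d. a j * y j = b\<close>, or the inequality \<open>\<Sum>j<d. a j * y j \<le> b\<close>
  (nonnegativity constraints are inequalities of this form); \<open>ef_map F i = (t, t\<^sub>0)\<close> says that the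
  coordinate \<open>i\<close> of the affine map is \<open>(\<Sum>j<d. t j * y j) + t\<^sub>0\<close>. Values of the coefficient functions
  outside \<open>{..<d}\<close> are irrelevant.
\<close>

record 'i ext_form =
  ef_dim :: nat
  ef_eqs :: "((nat \<Rightarrow> rat) \<times> rat) list"
  ef_ineqs :: "((nat \<Rightarrow> rat) \<times> rat) list"
  ef_map :: "'i \<Rightarrow> (nat \<Rightarrow> rat) \<times> rat"

definition lin_form :: "nat \<Rightarrow> (nat \<Rightarrow> rat) \<Rightarrow> (nat \<Rightarrow>\<^sub>0 real) \<Rightarrow> real" where
  "lin_form d a y = (\<Sum>j<d. of_rat (a j) * Poly_Mapping.lookup y j)"

definition ef_polyhedron :: "'i ext_form \<Rightarrow> (nat \<Rightarrow>\<^sub>0 real) set" where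
  "ef_polyhedron F =
     {y \<in> coord_space {..<ef_dim F}.
        (\<forall>(a, b)\<in>set (ef_eqs F). lin_form (ef_dim F) a y = of_rat b) \<and>
        (\<forall>(a, b)\<in>set (ef_ineqs F). lin_form (ef_dim F) a y \<le> of_rat b)}"

definition ef_affine_map :: "'i ext_form \<Rightarrow> 'i set \<Rightarrow> (nat \<Rightarrow>\<^sub>0 real) \<Rightarrow> ('i \<Rightarrow>\<^sub>0 real)" where
  "ef_affine_map F I y =
     (\<Sum>i\<in>I. case ef_map F i of (t, t0) \<Rightarrow>
        Poly_Mapping.single i (lin_form (ef_dim F) t y + of_rat t0))"

definition is_extended_formulation ::
    "'i ext_form \<Rightarrow> 'i set \<Rightarrow> ('i \<Rightarrow>\<^sub>0 real) set \<Rightarrow> bool" where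
  "is_extended_formulation F I P \<longleftrightarrow> ef_affine_map F I ` ef_polyhedron F = P"

definition ef_size :: "'i ext_form \<Rightarrow> nat" where
  "ef_size F = length (ef_ineqs F)"

text \<open>The total encoding length of all coefficients (zeros included) of the equations, the
  inequalities and the affine map. Bounding the total, rather than each coefficient separately, also
  bounds the number of variables and equations, so that large coefficients cannot be hidden in long
  chains of equations such as \<open>y\<^sub>1 = 2 * y\<^sub>0\<close>, \<open>y\<^sub>2 = 2 * y\<^sub>1\<close>, \<open>\<dots>\<close>.\<close>

definition row_encoding_length :: "nat \<Rightarrow> (nat \<Rightarrow> rat) \<times> rat \<Rightarrow> nat" where
  "row_encoding_length d = (\<lambda>(a, b). (\<Sum>j<d. encoding_length (a j)) + encoding_length b)"

definition ef_encoding_length :: "'i ext_form \<Rightarrow> 'i set \<Rightarrow> nat" where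
  "ef_encoding_length F I =
     (\<Sum>r\<leftarrow>ef_eqs F. row_encoding_length (ef_dim F) r) +
     (\<Sum>r\<leftarrow>ef_ineqs F. row_encoding_length (ef_dim F) r) +
     (\<Sum>i\<in>I. row_encoding_length (ef_dim F) (ef_map F i))"

text \<open>A family of polytopes \<open>P k \<subseteq> \<real>\<^bsup>I k\<^esup>\<close>, \<open>k \<in> K\<close>, with finite \<open>I k\<close>. The polynomial \<open>q\<close> in the two
  quantities \<open>m = card (I k)\<close> and \<open>s\<close>, the maximal encoding length of the components of the vertices,
  is a polynomial in \<open>s\<close> with coefficients that are polynomials in \<open>m\<close>; it is chosen uniformly for
  the family.\<close>

definition has_compact_extended_formulations ::
    "'k set \<Rightarrow> ('k \<Rightarrow> 'i set) \<Rightarrow> ('k \<Rightarrow> ('i \<Rightarrow>\<^sub>0 real) set) \<Rightarrow> bool" where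
  "has_compact_extended_formulations K I P \<longleftrightarrow>
     (\<exists>q :: real poly poly. \<forall>k\<in>K. \<exists>F.
        is_extended_formulation F (I k) (P k) \<and>
        (let m = real (card (I k));
             s = real (vertex_encoding_length (I k) (P k));
             bound = poly (poly q [:s:]) m
         in real (ef_size F) \<le> bound \<and> real (ef_encoding_length F (I k)) \<le> bound))"

end

theory Submission
  imports Defs
begin

text \<open>Colour coding: if \<open>f\<close> colours \<open>{1..n}\<close> with \<open>l\<close> colours, the cycles that are rainbow under \<open>f\<close> are
  the closed walks found by a dynamic program that remembers only the start, the current vertex and
  the set of colours used, so they are the paths of a layered network with \<open>n\<^sup>2 * 2 ^ l\<close> nodes. A
  random \<open>f\<close> is injective on a given \<open>l\<close>-set with probability \<open>l! / l ^ l \<ge> exp (- l)\<close>, so greedily chosen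
  \<open>\<lfloor>exp l * l * ln n\<rfloor> + 1\<close> colourings make every \<open>l\<close>-cycle rainbow for some \<open>f\<close>. Placing the networks
  of all these colourings side by side, the unit flows project onto the convex hull of all \<open>l\<close>-cycles,
  and for \<open>l \<le> c * ln n\<close> every count is polynomial in \<open>n\<close>.\<close>

section \<open>Flows in layered networks\<close>

text \<open>The vectors carried by an amount \<open>M\<close> of flow whose unit shares lie in the
  hull of \<open>H\<close>. The separate case \<open>M = 0\<close> matters for empty
  \<open>H\<close>: an arc without flow may be reached by no path, yet must carry the share
  0.\<close>

definition scaled_hull :: "real \<Rightarrow> 'v::real_vector set \<Rightarrow> 'v set" where
  "scaled_hull M H = (if M = 0 then {0} else (*\<^sub>R) M ` (convex hull H))"

lemma scaled_hull_1: "scaled_hull 1 H = convex hull H"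
  by (simp add: scaled_hull_def)

lemma scaled_hull_mono: "H \<subseteq> H' \<Longrightarrow> scaled_hull M H \<subseteq> scaled_hull M H'"
  using hull_mono[of H H' convex] by (auto simp: scaled_hull_def)

lemma scaled_hull_scaleR:
  assumes "x \<in> scaled_hull M H"
  shows "c *\<^sub>R x \<in> scaled_hull (c * M) H"
  using assms by (auto simp: scaled_hull_def split: if_splits)

text \<open>For positive masses, \<open>M u + N v\<close> is \<open>M + N\<close> times the convex
  combination of \<open>u\<close> and \<open>v\<close> with weights \<open>M / (M + N)\<close> and
  \<open>N / (M + N)\<close>.\<close>

lemma scaled_hull_add:
  assumes "0 \<le> M" "0 \<le> N" "x \<in> scaled_hull M H" "y \<in> scaled_hull N H"
  shows "x + y \<in> scaled_hull (M + N) H"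
proof (cases "M = 0 \<or> N = 0")
  case True
  then show ?thesis using assms by (auto simp: scaled_hull_def split: if_splits)
next
  case False
  then have pos: "M > 0" "N > 0" using assms by auto
  obtain u v where u: "u \<in> convex hull H" "x = M *\<^sub>R u" and v: "v \<in> convex hull H" "y = N *\<^sub>R v"
    using assms False by (auto simp: scaled_hull_def)
  have "(M / (M + N)) *\<^sub>R u + (N / (M + N)) *\<^sub>R v \<in> convex hull H"
    using u v pos
    by (intro convexD[OF convex_convex_hull]) (auto simp flip: add_divide_distrib)
  moreover have "x + y = (M + N) *\<^sub>R ((M / (M + N)) *\<^sub>R u + (N / (M + N)) *\<^sub>R v)"
    using u v pos by (simp add: scaleR_add_right)
  ultimately show ?thesis using pos by (auto simp: scaled_hull_def)
qed

lemma scaled_hull_sum: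
  assumes "finite S" "\<And>i. i \<in> S \<Longrightarrow> 0 \<le> M i" "\<And>i. i \<in> S \<Longrightarrow> w i \<in> scaled_hull (M i) H"
  shows "(\<Sum>i\<in>S. w i) \<in> scaled_hull (\<Sum>i\<in>S. M i) H"
  using assms
proof (induction S rule: finite_induct)
  case empty
  then show ?case by (simp add: scaled_hull_def)
next
  case (insert i S)
  then show ?case by (auto intro!: scaled_hull_add sum_nonneg)
qed

text \<open>Used to append one arc to every path in a share: each path vector moves by
  \<open>v\<close>, so a share of mass \<open>M\<close> moves by \<open>M\<close> times
  \<open>v\<close>.\<close>

lemma scaled_hull_translation:
  assumes "x \<in> scaled_hull M H"
  shows "x + M *\<^sub>R v \<in> scaled_hull M ((+) v ` H)"
  using assms
  by (auto simp: scaled_hull_def convex_hull_translation image_image scaleR_add_right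
      add.commute[of _ "M *\<^sub>R v"] split: if_splits)

section \<open>Unit flows and their decomposition into paths\<close>

text \<open>Every arc climbs exactly one layer, so there are no directed cycles, and flow
  decomposition can proceed by induction on layers.\<close>

locale layered_network =
  fixes A :: "'a set" and tail head :: "'a \<Rightarrow> 'z" and rank :: "'z \<Rightarrow> nat" and L :: nat
  assumes finite_arcs: "finite A"
    and rank_head: "a \<in> A \<Longrightarrow> rank (head a) = Suc (rank (tail a))"
    and rank_tail: "a \<in> A \<Longrightarrow> rank (tail a) < L"
    and depth_pos: "0 < L"
begin

text \<open>The nodes subject to conservation. All nodes of rank 0 act as sources and all nodes of
  rank \<open>L\<close> as sinks.\<close>

definition inner_nodes :: "'z set" where
  "inner_nodes = {z \<in> head ` A \<union> tail ` A. 0 < rank z \<and> rank z < L}"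

definition flows :: "('a \<Rightarrow> real) set" where
  "flows = {y. (\<forall>a\<in>A. 0 \<le> y a) \<and>
     (\<forall>z\<in>inner_nodes. (\<Sum>a\<in>{a\<in>A. head a = z}. y a) = (\<Sum>a\<in>{a\<in>A. tail a = z}. y a)) \<and>
     (\<Sum>a\<in>{a\<in>A. rank (tail a) = 0}. y a) = 1}"

definition paths :: "nat \<Rightarrow> 'a list set" where
  "paths k = {as. length as = k \<and> set as \<subseteq> A \<and> (\<forall>i<k. rank (tail (as ! i)) = i) \<and>
     (\<forall>i. Suc i < k \<longrightarrow> head (as ! i) = tail (as ! Suc i))}"

lemma finite_inner_nodes: "finite inner_nodes"
  using finite_arcs by (auto simp: inner_nodes_def)

lemma paths_snoc:
  assumes "as \<in> paths (Suc k)" "last as = b" "a \<in> A" "head b = tail a"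
  shows "as @ [a] \<in> paths (Suc (Suc k))"
proof -
  have len: "length as = Suc k" using assms by (auto simp: paths_def)
  have b: "b = as ! k" using assms(2) len by (metis diff_Suc_1 last_conv_nth list.size(3) nat.distinct(1))
  have "b \<in> A" "rank (tail b) = k" using assms(1) b len by (auto simp: paths_def)
  then have "rank (tail a) = Suc k" using rank_head assms(4) by metis
  then have ranks: "rank (tail ((as @ [a]) ! i)) = i" if "i < Suc (Suc k)" for i
    using assms(1) that len by (cases "i = Suc k") (auto simp: paths_def nth_append)
  have "head ((as @ [a]) ! i) = tail ((as @ [a]) ! Suc i)" if "Suc i < Suc (Suc k)" for i
    using assms(1,4) b that len by (cases "i = k") (auto simp: paths_def nth_append)
  then show ?thesis using assms(1,3) ranks len by (auto simp: paths_def)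
qed

text \<open>By conservation, the mass of layer \<open>k\<close> entering the nodes of rank
  \<open>k + 1\<close> equals the mass leaving them; grouping both layers of arcs by these nodes
  passes the total 1 on.\<close>

lemma flow_layer_mass:
  assumes "y \<in> flows" "k < L"
  shows "(\<Sum>a\<in>{a\<in>A. rank (tail a) = k}. y a) = 1"
  using assms(2)
proof (induction k)
  case 0
  then show ?case using assms by (simp add: flows_def)
next
  case (Suc k)
  let ?N = "{z \<in> inner_nodes. rank z = Suc k}"
  have fin: "finite ?N" using finite_inner_nodes by auto
  have "(\<Sum>a\<in>{a\<in>A. rank (tail a) = Suc k}. y a) =
      (\<Sum>z\<in>?N. \<Sum>a\<in>{a\<in>{a\<in>A. rank (tail a) = Suc k}. tail a = z}. y a)"
    using fin finite_arcs rank_tail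
    by (intro sum.group[symmetric]) (auto simp: inner_nodes_def)
  also have "\<dots> = (\<Sum>z\<in>?N. \<Sum>a\<in>{a\<in>A. tail a = z}. y a)"
    by (intro sum.cong) auto
  also have "\<dots> = (\<Sum>z\<in>?N. \<Sum>a\<in>{a\<in>A. head a = z}. y a)"
    using assms(1) unfolding flows_def by (intro sum.cong[OF refl]) simp
  also have "\<dots> = (\<Sum>z\<in>?N. \<Sum>a\<in>{a\<in>{a\<in>A. rank (tail a) = k}. head a = z}. y a)"
    using rank_head by (intro sum.cong) auto
  also have "\<dots> = (\<Sum>a\<in>{a\<in>A. rank (tail a) = k}. y a)"
    using fin finite_arcs rank_head Suc.prems
    by (intro sum.group) (auto simp: inner_nodes_def)
  finally show ?case using Suc by simp
qed

text \<open>Each arc \<open>a\<close> of layer \<open>k\<close> receives a share of mass \<open>y a\<close> of the paths ending with \<open>a\<close>; in the step, the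
  mass arriving at a node is split among the outgoing arcs in proportion to the flow on them.\<close>

lemma flow_prefix_decomposition:
  fixes vec :: "'a \<Rightarrow> 'v::real_vector"
  assumes y: "y \<in> flows" and "k < L"
  shows "\<exists>w. (\<forall>a\<in>A. rank (tail a) = k \<longrightarrow>
             w a \<in> scaled_hull (y a) ((\<lambda>as. \<Sum>b\<leftarrow>as. vec b) ` {as \<in> paths (Suc k). last as = a})) \<and>
           (\<Sum>a\<in>{a\<in>A. rank (tail a) = k}. w a) = (\<Sum>a\<in>{a\<in>A. rank (tail a) \<le> k}. y a *\<^sub>R vec a)"
  using assms(2)
proof (induction k)
  case 0
  have "y a *\<^sub>R vec a \<in> scaled_hull (y a) ((\<lambda>as. \<Sum>b\<leftarrow>as. vec b) ` {as \<in> paths (Suc 0). last as = a})"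
    if "a \<in> A" "rank (tail a) = 0" for a
  proof -
    have "[a] \<in> {as \<in> paths (Suc 0). last as = a}"
      using that by (auto simp: paths_def)
    then have "vec a \<in> (\<lambda>as. \<Sum>b\<leftarrow>as. vec b) ` {as \<in> paths (Suc 0). last as = a}"
      by (rule rev_image_eqI) simp
    then show ?thesis by (auto simp: scaled_hull_def intro: hull_inc)
  qed
  then show ?case by (intro exI[of _ "\<lambda>a. y a *\<^sub>R vec a"]) auto
next
  case (Suc k)
  let ?H = "\<lambda>k a. (\<lambda>as. \<Sum>b\<leftarrow>as. vec b) ` {as \<in> paths (Suc k). last as = a}"
  let ?in = "\<lambda>z. {a\<in>A. head a = z}" and ?out = "\<lambda>z. {a\<in>A. tail a = z}"
  have nonneg: "0 \<le> y a" if "a \<in> A" for a using y that by (auto simp: flows_def)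
  obtain w where w: "\<And>a. a \<in> A \<Longrightarrow> rank (tail a) = k \<Longrightarrow> w a \<in> scaled_hull (y a) (?H k a)"
    and wsum: "(\<Sum>a\<in>{a\<in>A. rank (tail a) = k}. w a) = (\<Sum>a\<in>{a\<in>A. rank (tail a) \<le> k}. y a *\<^sub>R vec a)"
    using Suc by auto
  define m where "m z = (\<Sum>a\<in>?in z. y a)" for z
  define W where "W z = (\<Sum>a\<in>?in z. w a)" for z
  have m_nonneg: "0 \<le> m z" for z using nonneg by (auto simp: m_def intro: sum_nonneg)
  have m_out: "m z = (\<Sum>a\<in>?out z. y a)" if "z \<in> inner_nodes" for z
    using y that by (auto simp: flows_def m_def)
  \<comment> \<open>All paths arriving at \<open>z\<close> are pooled, whichever arc they end with,
    since any of them can be continued by any arc leaving \<open>z\<close>.\<close>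
  have W: "W z \<in> scaled_hull (m z) (\<Union>b\<in>?in z. ?H k b)" if "rank z = Suc k" for z
    unfolding W_def m_def
  proof (rule scaled_hull_sum)
    fix b assume b: "b \<in> ?in z"
    then have "rank (tail b) = k" using that rank_head by force
    then have "w b \<in> scaled_hull (y b) (?H k b)" using w b by auto
    moreover have "?H k b \<subseteq> (\<Union>b\<in>?in z. ?H k b)" using b by (intro UN_upper)
    ultimately show "w b \<in> scaled_hull (y b) (\<Union>b\<in>?in z. ?H k b)"
      using scaled_hull_mono by blast
  qed (use finite_arcs nonneg in auto)
  \<comment> \<open>If no mass arrives at the tail, the quotient is 0 by convention; then
    \<open>y a = 0\<close> and \<open>W (tail a) = 0\<close> as well, so nothing is lost.\<close>
  define w' where "w' a = (y a / m (tail a)) *\<^sub>R W (tail a) + y a *\<^sub>R vec a" for a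
  have inner: "tail a \<in> inner_nodes" if "a \<in> A" "rank (tail a) = Suc k" for a
    using that Suc.prems by (auto simp: inner_nodes_def)
  have y_zero: "y a = 0" if "a \<in> A" "rank (tail a) = Suc k" "m (tail a) = 0" for a
  proof -
    have "(\<Sum>b\<in>?out (tail a). y b) = 0" using m_out[OF inner] that by simp
    then show ?thesis
      using that nonneg finite_arcs by (subst (asm) sum_nonneg_eq_0_iff) auto
  qed
  have w': "w' a \<in> scaled_hull (y a) (?H (Suc k) a)" if a: "a \<in> A" "rank (tail a) = Suc k" for a
  proof -
    let ?U = "\<Union>b\<in>?in (tail a). ?H k b"
    have "(y a / m (tail a)) *\<^sub>R W (tail a) \<in> scaled_hull (y a / m (tail a) * m (tail a)) ?U"
      by (rule scaled_hull_scaleR[OF W]) (use a in simp)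
    also have "y a / m (tail a) * m (tail a) = y a"
      using y_zero[OF a] by auto
    finally have "w' a \<in> scaled_hull (y a) ((+) (vec a) ` ?U)"
      unfolding w'_def by (rule scaled_hull_translation)
    moreover have "(+) (vec a) ` ?U \<subseteq> ?H (Suc k) a"
    proof
      fix u assume "u \<in> (+) (vec a) ` ?U"
      then obtain b as where b: "b \<in> A" "head b = tail a" "as \<in> paths (Suc k)" "last as = b"
        and u: "u = vec a + (\<Sum>b\<leftarrow>as. vec b)" by auto
      have "as @ [a] \<in> {as \<in> paths (Suc (Suc k)). last as = a}"
        using paths_snoc b a by auto
      then show "u \<in> ?H (Suc k) a" by (rule rev_image_eqI) (simp add: u add.commute)
    qed
    ultimately show ?thesis by (rule rev_subsetD[OF _ scaled_hull_mono])
  qed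
  let ?N = "{z \<in> inner_nodes. rank z = Suc k}"
  let ?layer = "\<lambda>k. {a\<in>A. rank (tail a) = k}"
  have fin: "finite ?N" using finite_inner_nodes by auto
  have "(\<Sum>a\<in>?layer (Suc k). (y a / m (tail a)) *\<^sub>R W (tail a)) =
      (\<Sum>z\<in>?N. \<Sum>a\<in>{a\<in>?layer (Suc k). tail a = z}. (y a / m (tail a)) *\<^sub>R W (tail a))"
    using fin finite_arcs inner by (intro sum.group[symmetric]) auto
  also have "\<dots> = (\<Sum>z\<in>?N. \<Sum>a\<in>?out z. (y a / m z) *\<^sub>R W z)"
    by (intro sum.cong) auto
  also have "\<dots> = (\<Sum>z\<in>?N. W z)"
  proof (rule sum.cong)
    fix z assume z: "z \<in> ?N"
    have "(\<Sum>a\<in>?out z. (y a / m z) *\<^sub>R W z) = (m z / m z) *\<^sub>R W z"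
      using m_out[of z] z by (simp flip: scaleR_sum_left sum_divide_distrib)
    also have "\<dots> = W z"
      using W[of z] z by (cases "m z = 0") (auto simp: scaled_hull_def)
    finally show "(\<Sum>a\<in>?out z. (y a / m z) *\<^sub>R W z) = W z" .
  qed simp
  also have "\<dots> = (\<Sum>z\<in>?N. \<Sum>a\<in>{a\<in>?layer k. head a = z}. w a)"
    unfolding W_def using rank_head by (intro sum.cong) auto
  also have "\<dots> = (\<Sum>a\<in>?layer k. w a)"
    using fin finite_arcs rank_head Suc.prems
    by (intro sum.group) (auto simp: inner_nodes_def)
  finally have "(\<Sum>a\<in>?layer (Suc k). w' a) =
      (\<Sum>a\<in>{a\<in>A. rank (tail a) \<le> k}. y a *\<^sub>R vec a) + (\<Sum>a\<in>?layer (Suc k). y a *\<^sub>R vec a)"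
    unfolding w'_def sum.distrib wsum by (rule arg_cong)
  also have "\<dots> = (\<Sum>a\<in>{a\<in>A. rank (tail a) \<le> k} \<union> ?layer (Suc k). y a *\<^sub>R vec a)"
    using finite_arcs by (intro sum.union_disjoint[symmetric]) auto
  also have "{a\<in>A. rank (tail a) \<le> k} \<union> ?layer (Suc k) = {a\<in>A. rank (tail a) \<le> Suc k}"
    by auto
  finally show ?case using w' by (intro exI[of _ w'] conjI ballI impI)
qed

text \<open>The prefix decomposition at the last layer \<open>L - 1\<close> accounts for all arcs,
  and the masses there sum to 1, so the dilated hull is the hull itself.\<close>

lemma flow_in_hull_paths:
  fixes vec :: "'a \<Rightarrow> 'v::real_vector"
  assumes "y \<in> flows"
  shows "(\<Sum>a\<in>A. y a *\<^sub>R vec a) \<in> convex hull ((\<lambda>as. \<Sum>a\<leftarrow>as. vec a) ` paths L)"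
proof -
  let ?H = "\<lambda>a. (\<lambda>as. \<Sum>b\<leftarrow>as. vec b) ` {as \<in> paths L. last as = a}"
  let ?top = "{a\<in>A. rank (tail a) = L - 1}"
  have L: "L - 1 < L" "Suc (L - 1) = L" using depth_pos by auto
  obtain w where w: "\<And>a. a \<in> A \<Longrightarrow> rank (tail a) = L - 1 \<Longrightarrow> w a \<in> scaled_hull (y a) (?H a)"
    and wsum: "(\<Sum>a\<in>?top. w a) = (\<Sum>a\<in>{a\<in>A. rank (tail a) \<le> L - 1}. y a *\<^sub>R vec a)"
    using flow_prefix_decomposition[OF assms L(1), of vec] unfolding L(2) by auto
  have "(\<Sum>a\<in>?top. w a) \<in> scaled_hull (\<Sum>a\<in>?top. y a) ((\<lambda>as. \<Sum>a\<leftarrow>as. vec a) ` paths L)"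
  proof (rule scaled_hull_sum)
    fix a assume a: "a \<in> ?top"
    have "?H a \<subseteq> (\<lambda>as. \<Sum>a\<leftarrow>as. vec a) ` paths L" by auto
    then show "w a \<in> scaled_hull (y a) ((\<lambda>as. \<Sum>a\<leftarrow>as. vec a) ` paths L)"
      using w[of a] a scaled_hull_mono by blast
  qed (use finite_arcs assms in \<open>auto simp: flows_def\<close>)
  moreover have "{a\<in>A. rank (tail a) \<le> L - 1} = A" using rank_tail L by force
  ultimately show ?thesis
    using flow_layer_mass[OF assms L(1)] wsum by (simp add: scaled_hull_1)
qed

section \<open>Paths as flows, and the projection of the flow polyhedron\<close>

lemma path_distinct: "as \<in> paths k \<Longrightarrow> distinct as"
  by (rule distinct_map[THEN iffD1, THEN conjunct1, of "\<lambda>a. rank (tail a)"])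
    (auto simp: paths_def distinct_conv_nth)

text \<open>A path has exactly one arc in each layer, and consecutive arcs share a node; hence one
  unit leaves layer 0, and every inner node has equal inflow and outflow, either 0 or 1.\<close>

lemma path_indicator_flow:
  assumes as: "as \<in> paths L"
  shows "(\<lambda>a. if a \<in> set as then 1 else 0) \<in> flows"
proof -
  have len: "length as = L" and sub: "set as \<subseteq> A" using as by (auto simp: paths_def)
  have sum_card: "(\<Sum>a\<in>{a\<in>A. P a}. if a \<in> set as then 1 else 0) = real (card {a \<in> set as. P a})"
    for P
  proof -
    have "(\<Sum>a\<in>{a\<in>A. P a}. if a \<in> set as then 1 else 0) = (\<Sum>a\<in>{a \<in> set as. P a}. 1::real)"
      using finite_arcs sub by (intro sum.mono_neutral_cong_right) auto
    then show ?thesis by simp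
  qed
  \<comment> \<open>A property that confines arcs to layer \<open>i\<close> can hold on the path
    only for \<open>as ! i\<close>.\<close>
  have layer: "{a \<in> set as. P a} = (if P (as ! i) then {as ! i} else {})"
    if "i < L" "\<And>a. a \<in> set as \<Longrightarrow> P a \<Longrightarrow> rank (tail a) = i" for P i
  proof -
    have "a = as ! i" if "a \<in> set as" "rank (tail a) = i" for a
      using that as by (auto simp: paths_def in_set_conv_nth)
    then show ?thesis using that len by auto
  qed
  have "card {a \<in> set as. head a = z} = card {a \<in> set as. tail a = z}" if "z \<in> inner_nodes" for z
  proof -
    define k where "k = rank z - 1"
    have k: "rank z = Suc k" "Suc k < L" using that by (auto simp: inner_nodes_def k_def)
    have "{a \<in> set as. head a = z} = (if head (as ! k) = z then {as ! k} else {})"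
      by (rule layer) (use k rank_head sub in force)+
    moreover have "{a \<in> set as. tail a = z} = (if tail (as ! Suc k) = z then {as ! Suc k} else {})"
      by (rule layer) (use k in auto)
    moreover have "head (as ! k) = tail (as ! Suc k)" using as k by (auto simp: paths_def)
    ultimately show ?thesis by auto
  qed
  moreover have "card {a \<in> set as. rank (tail a) = 0} = 1"
    using layer[of 0 "\<lambda>a. rank (tail a) = 0"] depth_pos as by (simp add: paths_def)
  ultimately show ?thesis
    unfolding flows_def by (simp add: sum_card)
qed

lemma flows_convex:
  assumes "y \<in> flows" "y' \<in> flows" "0 \<le> u" "0 \<le> v" "u + v = 1"
  shows "(\<lambda>a. u * y a + v * y' a) \<in> flows"
  using assms unfolding flows_def
  by (auto simp: sum.distrib simp flip: sum_distrib_left)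

text \<open>One inclusion is the path decomposition. For the other, the image of the flows is convex
  and contains every path vector as the image of the indicator of that path.\<close>

theorem flow_image_eq_hull_paths:
  fixes vec :: "'a \<Rightarrow> 'v::real_vector"
  shows "(\<lambda>y. \<Sum>a\<in>A. y a *\<^sub>R vec a) ` flows = convex hull ((\<lambda>as. \<Sum>a\<leftarrow>as. vec a) ` paths L)"
    (is "?f ` flows = convex hull ?V")
proof
  show "?f ` flows \<subseteq> convex hull ?V" using flow_in_hull_paths by auto
  have "convex (?f ` flows)"
  proof (rule convexI)
    fix x x' u v assume "x \<in> ?f ` flows" "x' \<in> ?f ` flows" and uv: "0 \<le> u" "0 \<le> v" "u + v = (1::real)"
    then obtain y y' where y: "y \<in> flows" "y' \<in> flows" "x = ?f y" "x' = ?f y'" by auto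
    have "u *\<^sub>R x + v *\<^sub>R x' = ?f (\<lambda>a. u * y a + v * y' a)"
      by (simp add: y scaleR_sum_right sum.distrib scaleR_add_left)
    then show "u *\<^sub>R x + v *\<^sub>R x' \<in> ?f ` flows" using flows_convex[OF y(1,2) uv] by (rule image_eqI)
  qed
  moreover have "?V \<subseteq> ?f ` flows"
  proof
    fix x assume "x \<in> ?V"
    then obtain as where as: "as \<in> paths L" "x = (\<Sum>a\<leftarrow>as. vec a)" by auto
    have "x = (\<Sum>a\<in>set as. vec a)" using as path_distinct by (simp add: sum_list_distinct_conv_sum_set)
    also have "\<dots> = ?f (\<lambda>a. if a \<in> set as then 1 else 0)"
      using as finite_arcs by (intro sum.mono_neutral_cong_left) (auto simp: paths_def)
    finally show "x \<in> ?f ` flows" using path_indicator_flow[OF as(1)] by (rule image_eqI)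
  qed
  ultimately show "convex hull ?V \<subseteq> ?f ` flows" by (simp add: hull_minimal)
qed

end

section \<open>Flow formulations\<close>

lemma lookup_scaleR:
  "Poly_Mapping.lookup (r *\<^sub>R x) i = r *\<^sub>R Poly_Mapping.lookup (x :: 'i \<Rightarrow>\<^sub>0 'b::real_vector) i"
proof -
  have "finite {i. r *\<^sub>R Poly_Mapping.lookup x i \<noteq> 0}"
    by (rule finite_subset[OF _ finite_keys[of x]]) (auto simp: in_keys_iff)
  then show ?thesis by (simp add: scaleR_poly_mapping_def Abs_poly_mapping_inverse)
qed

text \<open>One bit each for sign, numerator and denominator; the flow formulations below have no
  other coefficients.\<close>

lemma encoding_length_unit: "r \<in> {-1, 0, 1} \<Longrightarrow> encoding_length r \<le> 3"
  by (auto simp: encoding_length_def rat_uminus_code)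

lemma row_encoding_length_unit:
  assumes "\<And>j. j < d \<Longrightarrow> a j \<in> {-1, 0, 1}" "b \<in> {-1, 0, 1}"
  shows "row_encoding_length d (a, b) \<le> 3 * (d + 1)"
proof -
  have "(\<Sum>j<d. encoding_length (a j)) \<le> of_nat (card {..<d}) * 3"
    using assms(1) by (intro sum_bounded_above encoding_length_unit) auto
  then show ?thesis
    using encoding_length_unit[OF assms(2)] by (simp add: row_encoding_length_def)
qed

context layered_network
begin

lemma flows_cong:
  assumes "\<And>a. a \<in> A \<Longrightarrow> y a = y' a"
  shows "y \<in> flows \<longleftrightarrow> y' \<in> flows"
proof -
  have "sum y {a\<in>A. P a} = sum y' {a\<in>A. P a}" for P
    using assms by (intro sum.cong) auto
  then show ?thesis using assms by (simp add: flows_def)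
qed

lemma card_inner_nodes: "card inner_nodes \<le> 2 * card A"
proof -
  have "card inner_nodes \<le> card (head ` A \<union> tail ` A)"
    using finite_arcs by (intro card_mono) (auto simp: inner_nodes_def)
  also have "\<dots> \<le> card (head ` A) + card (tail ` A)" by (rule card_Un_le)
  also have "\<dots> \<le> card A + card A" by (intro add_mono card_image_le finite_arcs)
  finally show ?thesis by simp
qed

text \<open>Here \<open>e\<close> is meant to enumerate the arcs and \<open>zs\<close> the inner
  nodes: variable \<open>j\<close> is the flow on arc \<open>e j\<close>. The affine map adds up the
  flow on all arcs with the same label.\<close>

definition flow_formulation :: "(nat \<Rightarrow> 'a) \<Rightarrow> 'z list \<Rightarrow> ('a \<Rightarrow> 'i) \<Rightarrow> 'i ext_form" where
  "flow_formulation e zs lab = \<lparr>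
     ef_dim = card A,
     ef_eqs = (\<lambda>j. of_bool (rank (tail (e j)) = 0), 1) #
       map (\<lambda>z. (\<lambda>j. of_bool (head (e j) = z) - of_bool (tail (e j) = z), 0)) zs,
     ef_ineqs = map (\<lambda>i. (\<lambda>j. - of_bool (j = i), 0)) [0..<card A],
     ef_map = (\<lambda>i. (\<lambda>j. of_bool (lab (e j) = i), 0))\<rparr>"

text \<open>There are at most \<open>1 + 2 * card A\<close> equations, \<open>card A\<close>
  inequalities and \<open>card I\<close> rows of the map, each with \<open>card A + 1\<close>
  entries of length at most 3.\<close>

lemma flow_formulation_encoding_length:
  assumes "finite I" "length zs = card inner_nodes"
  shows "ef_encoding_length (flow_formulation e zs lab) I
    \<le> (3 * card A + 1 + card I) * (3 * (card A + 1))"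
proof -
  let ?F = "flow_formulation e zs lab" and ?d = "card A"
  have sum_list_le: "(\<Sum>r\<leftarrow>rs. row_encoding_length ?d r) \<le> length rs * (3 * (?d + 1))"
    if "\<forall>r\<in>set rs. row_encoding_length ?d r \<le> 3 * (?d + 1)" for rs
    using that by (induction rs) auto
  have "(\<Sum>r\<leftarrow>ef_eqs ?F. row_encoding_length ?d r) \<le> (1 + 2 * ?d) * (3 * (?d + 1))"
  proof -
    have "\<forall>r\<in>set (ef_eqs ?F). row_encoding_length ?d r \<le> 3 * (?d + 1)"
      by (auto simp: flow_formulation_def intro!: row_encoding_length_unit[simplified])
    from sum_list_le[OF this] show ?thesis
      by (rule order_trans)
        (use assms card_inner_nodes in \<open>intro mult_right_mono, auto simp: flow_formulation_def\<close>)
  qed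
  moreover have "(\<Sum>r\<leftarrow>ef_ineqs ?F. row_encoding_length ?d r) \<le> ?d * (3 * (?d + 1))"
  proof -
    have "\<forall>r\<in>set (ef_ineqs ?F). row_encoding_length ?d r \<le> 3 * (?d + 1)"
      by (auto simp: flow_formulation_def intro!: row_encoding_length_unit[simplified])
    from sum_list_le[OF this] show ?thesis by (simp add: flow_formulation_def)
  qed
  moreover have "(\<Sum>i\<in>I. row_encoding_length ?d (ef_map ?F i)) \<le> of_nat (card I) * (3 * (?d + 1))"
    by (rule sum_bounded_above)
      (auto simp: flow_formulation_def intro!: row_encoding_length_unit[simplified])
  ultimately show ?thesis
    by (simp add: ef_encoding_length_def flow_formulation_def algebra_simps)
qed

lemma flow_formulation_correct:
  fixes lab :: "'a \<Rightarrow> 'i"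
  assumes e: "bij_betw e {..<card A} A" and zs: "set zs = inner_nodes"
    and lab: "lab ` A \<subseteq> I" and I: "finite I"
  shows "is_extended_formulation (flow_formulation e zs lab) I
    (convex hull ((\<lambda>as. \<Sum>a\<leftarrow>as. Poly_Mapping.single (lab a) (1::real)) ` paths L))"
proof -
  let ?d = "card A" and ?F = "flow_formulation e zs lab"
  let ?f = "\<lambda>Y. \<Sum>a\<in>A. Y a *\<^sub>R Poly_Mapping.single (lab a) (1::real)"
  \<comment> \<open>Reads a point of the variable space as a function on arcs.\<close>
  define Y where "Y y a = Poly_Mapping.lookup y (inv_into {..<?d} e a)" for y :: "nat \<Rightarrow>\<^sub>0 real" and a
  have Y_e: "Y y (e j) = Poly_Mapping.lookup y j" if "j < ?d" for y j
    using that e by (simp add: Y_def bij_betw_inv_into_left)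
  have lin: "lin_form ?d (\<lambda>j. c (e j)) y = (\<Sum>a\<in>A. of_rat (c a) * Y y a)" for c y
    unfolding lin_form_def using sum.reindex_bij_betw[OF e, of "\<lambda>a. of_rat (c a) * Y y a"]
    by (simp add: Y_e)
  have filter: "(\<Sum>a\<in>A. of_rat (of_bool (P a)) * Y y a) = (\<Sum>a\<in>{a\<in>A. P a}. Y y a)" for P y
    using finite_arcs by (intro sum.mono_neutral_cong_right ballI) auto
  have nonneg: "lin_form ?d (\<lambda>j. - of_bool (j = i)) y = - Poly_Mapping.lookup y i" if "i < ?d" for i y
  proof -
    have "lin_form ?d (\<lambda>j. - of_bool (j = i)) y = (\<Sum>j<?d. if j = i then - Poly_Mapping.lookup y i else 0)"
      unfolding lin_form_def by (intro sum.cong[OF refl]) (simp add: of_rat_minus)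
    then show ?thesis using that by simp
  qed
  have balance: "lin_form ?d (\<lambda>j. of_bool (head (e j) = z) - of_bool (tail (e j) = z)) y
      = (\<Sum>a\<in>{a\<in>A. head a = z}. Y y a) - (\<Sum>a\<in>{a\<in>A. tail a = z}. Y y a)" for z y
    using lin[of "\<lambda>a. of_bool (head a = z) - of_bool (tail a = z)" y]
    by (simp add: of_rat_diff left_diff_distrib sum_subtractf filter)
  have start: "lin_form ?d (\<lambda>j. of_bool (rank (tail (e j)) = 0)) y
      = (\<Sum>a\<in>{a\<in>A. rank (tail a) = 0}. Y y a)" for y
    using lin[of "\<lambda>a. of_bool (rank (tail a) = 0)" y] by (simp add: filter)
  have "(\<forall>a\<in>e ` {..<?d}. P a) \<longleftrightarrow> (\<forall>j<?d. P (e j))" for P by auto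
  then have "(\<forall>a\<in>A. P a) \<longleftrightarrow> (\<forall>j<?d. P (e j))" for P
    unfolding bij_betw_imp_surj_on[OF e] .
  then have "(\<forall>a\<in>A. 0 \<le> Y y a) \<longleftrightarrow> (\<forall>j<?d. 0 \<le> Poly_Mapping.lookup y j)" for y
    by (simp add: Y_e)
  then have polyhedron: "ef_polyhedron ?F = {y \<in> coord_space {..<?d}. Y y \<in> flows}"
    by (auto simp: ef_polyhedron_def flow_formulation_def flows_def zs[symmetric] start balance nonneg)
  have map: "ef_affine_map ?F I y = ?f (Y y)" for y
  proof (rule poly_mapping_eqI)
    fix i
    have "Poly_Mapping.lookup (ef_affine_map ?F I y) i =
        (if i \<in> I then \<Sum>a\<in>{a\<in>A. lab a = i}. Y y a else 0)"
      using I lin[of "\<lambda>a. of_bool (lab a = i)" y]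
      by (simp add: ef_affine_map_def flow_formulation_def lookup_sum lookup_single when_def filter)
    \<comment> \<open>No arc has a label outside \<open>I\<close>, so dropping these coordinates
      loses nothing.\<close>
    also have "\<dots> = (\<Sum>a\<in>{a\<in>A. lab a = i}. Y y a)"
      using lab by (auto simp: image_subset_iff intro!: sum.neutral)
    also have "\<dots> = Poly_Mapping.lookup (?f (Y y)) i"
      using finite_arcs
      by (auto simp: lookup_sum lookup_scaleR lookup_single when_def
          intro!: sum.mono_neutral_cong_left split: if_splits)
    finally show "Poly_Mapping.lookup (ef_affine_map ?F I y) i = Poly_Mapping.lookup (?f (Y y)) i" .
  qed
  have "?f ` flows \<subseteq> (\<lambda>y. ?f (Y y)) ` {y \<in> coord_space {..<?d}. Y y \<in> flows}"
  proof
    fix x assume "x \<in> ?f ` flows"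
    then obtain y' where y': "y' \<in> flows" "x = ?f y'" by auto
    \<comment> \<open>Flows are arbitrary off \<open>A\<close>, whereas a point of the polyhedron
      has its support in the first \<open>card A\<close> variables.\<close>
    define y where "y = (\<Sum>j<?d. Poly_Mapping.single j (y' (e j)))"
    have y: "Poly_Mapping.lookup y j = (if j < ?d then y' (e j) else 0)" for j
      by (simp add: y_def lookup_sum lookup_single when_def)
    then have "y \<in> coord_space {..<?d}" by (auto simp: coord_space_def in_keys_iff split: if_splits)
    moreover have eq: "Y y a = y' a" if "a \<in> A" for a
    proof -
      have "a \<in> e ` {..<?d}" unfolding bij_betw_imp_surj_on[OF e] by (rule that)
      then obtain j where "j < ?d" "a = e j" by auto
      then show ?thesis by (simp add: Y_e y)
    qed
    moreover have "Y y \<in> flows" using flows_cong[of "Y y" y'] eq y' by blast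
    moreover have "x = ?f (Y y)" using y' eq by (auto intro!: sum.cong)
    ultimately show "x \<in> (\<lambda>y. ?f (Y y)) ` {y \<in> coord_space {..<?d}. Y y \<in> flows}" by blast
  qed
  then have "ef_affine_map ?F I ` ef_polyhedron ?F = ?f ` flows"
    unfolding polyhedron map by blast
  then show ?thesis
    unfolding is_extended_formulation_def by (simp add: flow_image_eq_hull_paths)
qed

theorem network_extended_formulation:
  fixes lab :: "'a \<Rightarrow> 'i"
  assumes "lab ` A \<subseteq> I" "finite I"
  shows "\<exists>F. is_extended_formulation F I
       (convex hull ((\<lambda>as. \<Sum>a\<leftarrow>as. Poly_Mapping.single (lab a) (1::real)) ` paths L)) \<and>
     ef_size F = card A \<and>
     ef_encoding_length F I \<le> (3 * card A + 1 + card I) * (3 * (card A + 1))"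
proof -
  obtain e where e: "bij_betw e {..<card A} A"
    using ex_bij_betw_nat_finite[OF finite_arcs] by (auto simp: atLeast0LessThan)
  obtain zs where zs: "set zs = inner_nodes" "distinct zs"
    using finite_distinct_list[OF finite_inner_nodes] by auto
  have "ef_size (flow_formulation e zs lab) = card A"
    by (simp add: ef_size_def flow_formulation_def)
  then show ?thesis
    using flow_formulation_correct[OF e zs(1) assms]
      flow_formulation_encoding_length[OF assms(2), of zs e lab] zs distinct_card[OF zs(2)]
    by (intro exI[of _ "flow_formulation e zs lab"]) auto
qed

end

section \<open>Perfect hash families\<close>

text \<open>Double counting of the pairs in which \<open>f\<close> is not good for \<open>W\<close>:
  if every \<open>f\<close> missed more than the stated share, the total would exceed what the bound
  for each \<open>W\<close> permits.\<close>

lemma exists_below_average_misses: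
  fixes good :: "'f \<Rightarrow> 'w \<Rightarrow> bool" and p :: real
  assumes fin: "finite F" "F \<noteq> {}" "finite \<W>"
    and p: "\<And>W. W \<in> \<W> \<Longrightarrow> p * real (card F) \<le> real (card {f \<in> F. good f W})"
  shows "\<exists>f\<in>F. real (card {W \<in> \<W>. \<not> good f W}) \<le> (1 - p) * real (card \<W>)"
proof (rule ccontr)
  assume "\<not> ?thesis"
  then have "(\<Sum>f\<in>F. (1 - p) * real (card \<W>)) < (\<Sum>f\<in>F. real (card {W \<in> \<W>. \<not> good f W}))"
    using fin by (intro sum_strict_mono) (auto simp: not_le)
  also have "\<dots> = (\<Sum>W\<in>\<W>. real (card {f \<in> F. \<not> good f W}))"
    using sum_multicount_gen[OF fin(1,3), of "\<lambda>f W. \<not> good f W"]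
    by (simp flip: of_nat_sum)
  also have "\<dots> \<le> (\<Sum>W\<in>\<W>. (1 - p) * real (card F))"
  proof (rule sum_mono)
    fix W assume W: "W \<in> \<W>"
    have "card F = card ({f \<in> F. good f W} \<union> {f \<in> F. \<not> good f W})"
      by (rule arg_cong[of _ _ card]) auto
    also have "\<dots> = card {f \<in> F. good f W} + card {f \<in> F. \<not> good f W}"
      using fin by (intro card_Un_disjoint) auto
    finally show "real (card {f \<in> F. \<not> good f W}) \<le> (1 - p) * real (card F)"
      using p[OF W] by (simp add: algebra_simps)
  qed
  finally show False by (simp add: algebra_simps)
qed

text \<open>Each round adds an \<open>f\<close> that misses at most the fraction
  \<open>1 - p\<close> of the sets still uncovered. The same \<open>f\<close> may be chosen twice,
  hence only an upper bound on \<open>card G\<close>.\<close>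

lemma greedy_cover:
  fixes good :: "'f \<Rightarrow> 'w \<Rightarrow> bool" and p :: real
  assumes fin: "finite F" "F \<noteq> {}" "finite \<W>"
    and p: "\<And>W. W \<in> \<W> \<Longrightarrow> p * real (card F) \<le> real (card {f \<in> F. good f W})" and "p \<le> 1"
  shows "\<exists>G\<subseteq>F. finite G \<and> card G \<le> q \<and>
           real (card {W \<in> \<W>. \<forall>f\<in>G. \<not> good f W}) \<le> (1 - p) ^ q * real (card \<W>)"
proof (induction q)
  case 0
  show ?case by (intro exI[of _ "{}"]) auto
next
  case (Suc q)
  then obtain G where G: "G \<subseteq> F" "finite G" "card G \<le> q"
    and le: "real (card {W \<in> \<W>. \<forall>f\<in>G. \<not> good f W}) \<le> (1 - p) ^ q * real (card \<W>)" by auto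
  let ?R = "{W \<in> \<W>. \<forall>f\<in>G. \<not> good f W}"
  obtain f where f: "f \<in> F" "real (card {W \<in> ?R. \<not> good f W}) \<le> (1 - p) * real (card ?R)"
    using exists_below_average_misses[of F ?R p good] fin p by auto
  have "{W \<in> ?R. \<not> good f W} = {W \<in> \<W>. \<forall>g\<in>insert f G. \<not> good g W}" by auto
  then have "real (card {W \<in> \<W>. \<forall>g\<in>insert f G. \<not> good g W}) \<le> (1 - p) * real (card ?R)"
    using f by simp
  also have "\<dots> \<le> (1 - p) * ((1 - p) ^ q * real (card \<W>))"
    using le \<open>p \<le> 1\<close> by (intro mult_left_mono) auto
  finally show ?case
    using G f by (intro exI[of _ "insert f G"]) (auto simp: card_insert_if mult.assoc)
qed

section \<open>Colourings injective on a given set\<close>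

text \<open>The term of index \<open>l\<close> in the exponential series of \<open>l\<close> is at
  most the whole sum.\<close>

lemma power_le_fact_mult_exp: "real l ^ l \<le> fact l * exp (real l)"
proof -
  have "(\<Sum>n\<in>{l}. real l ^ n /\<^sub>R fact n) \<le> exp (real l)"
    unfolding exp_def by (rule sum_le_suminf[OF summable_exp_generic]) auto
  then show ?thesis by (simp add: field_simps)
qed

text \<open>Exactly \<open>l! * l ^ (card I - l)\<close> of the \<open>l ^ card I\<close> colourings
  are injective on \<open>W\<close>, a fraction of \<open>l! / l ^ l\<close>.\<close>

lemma card_injective_colourings:
  fixes W I :: "'a set"
  assumes "finite I" "W \<subseteq> I" "card W = l"
  shows "exp (- real l) * real (card (I \<rightarrow>\<^sub>E {..<l}))
     \<le> real (card {f \<in> I \<rightarrow>\<^sub>E {..<l}. inj_on f W})"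
proof -
  have le: "l \<le> card I" using assms card_mono by blast
  have "exp (- real l) * real (card (I \<rightarrow>\<^sub>E {..<l})) = exp (- real l) * real l ^ l * real l ^ (card I - l)"
    using assms le by (simp add: card_funcsetE flip: power_add)
  also have "\<dots> \<le> fact l * real l ^ (card I - l)"
    using power_le_fact_mult_exp[of l] by (intro mult_right_mono) (auto simp: exp_minus field_simps)
  also have "\<dots> = real (card {f \<in> I \<rightarrow>\<^sub>E {..<l}. inj_on f W})"
    using assms by (simp add: card_inj_on_subset_funcset fact_prod_rev)
  finally show ?thesis .
qed

text \<open>After \<open>q\<close> greedy rounds at most \<open>(1 - exp (- l)) ^ q * n ^ l\<close>
  sets are uncovered. By \<open>1 - p \<le> exp (- p)\<close> and the choice of \<open>q\<close>
  this is less than 1, so none is left.\<close>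

lemma perfect_hash_family:
  fixes l n q :: nat
  assumes "1 \<le> l" "1 \<le> n" and q: "exp (real l) * real l * ln (real n) < real q"
  shows "\<exists>G\<subseteq>{1..n} \<rightarrow>\<^sub>E {..<l}. finite G \<and> card G \<le> q \<and>
           (\<forall>W\<subseteq>{1..n}. card W = l \<longrightarrow> (\<exists>f\<in>G. inj_on f W))"
proof -
  let ?F = "{1..n} \<rightarrow>\<^sub>E {..<l}" and ?W = "{W. W \<subseteq> {1..n} \<and> card W = l}"
  define p where "p = exp (- real l)"
  have fin: "finite ?F" "?F \<noteq> {}" "finite ?W"
    using assms(1) by (auto simp: finite_PiE PiE_eq_empty_iff lessThan_empty_iff)
  have p: "0 \<le> p" "p \<le> 1" by (auto simp: p_def)
  obtain G where G: "G \<subseteq> ?F" "finite G" "card G \<le> q"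
    and le: "real (card {W \<in> ?W. \<forall>f\<in>G. \<not> inj_on f W}) \<le> (1 - p) ^ q * real (card ?W)"
    using greedy_cover[OF fin, of p "\<lambda>f W. inj_on f W" q] card_injective_colourings[of "{1..n}" _ l] p
    by (auto simp: p_def)
  have "card ?W \<le> n ^ l"
    using n_subsets[of "{1..n}" l] binomial_fact_pow[of n l]
    by (simp add: order_trans[OF _ binomial_fact_pow])
  then have W: "real (card ?W) \<le> real n ^ l" by (metis of_nat_le_iff of_nat_power)
  have "(1 - p) ^ q \<le> exp (- p) ^ q"
    using p exp_ge_add_one_self[of "-p"] by (intro power_mono) auto
  also have "\<dots> = exp (- (p * real q))" by (simp flip: exp_of_nat_mult add: mult.commute)
  also have "\<dots> < exp (- (real l * ln (real n)))"
    using q by (simp add: p_def exp_minus field_simps)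
  also have "\<dots> = inverse (real n ^ l)"
    using assms by (simp add: exp_minus exp_of_nat_mult)
  finally have "(1 - p) ^ q * real n ^ l < 1"
    using assms by (simp add: field_simps)
  moreover have "(1 - p) ^ q * real (card ?W) \<le> (1 - p) ^ q * real n ^ l"
    using W p by (intro mult_left_mono) auto
  ultimately have "card {W \<in> ?W. \<forall>f\<in>G. \<not> inj_on f W} = 0" using le by linarith
  then have "{W \<in> ?W. \<forall>f\<in>G. \<not> inj_on f W} = {}" using fin by (subst (asm) card_0_eq) auto
  then show ?thesis using G by (intro exI[of _ G]) auto
qed

section \<open>Cycles as paths in a network\<close>

text \<open>Two distinct positions with the same edge would be cyclic successors of each other,
  which forces the length to divide 2.\<close>

lemma cycle_edges_inj:
  assumes "distinct vs" "3 \<le> length vs"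
  shows "inj_on (\<lambda>i. {vs ! i, vs ! (Suc i mod length vs)}) {..<length vs}"
proof (rule inj_onI)
  fix i j
  let ?l = "length vs"
  assume ij: "i \<in> {..<?l}" "j \<in> {..<?l}"
    and eq: "{vs ! i, vs ! (Suc i mod ?l)} = {vs ! j, vs ! (Suc j mod ?l)}"
  have "Suc k mod ?l < ?l" for k using assms(2) by (intro mod_less_divisor) linarith
  then have "i = j \<or> i = Suc j mod ?l \<and> Suc i mod ?l = j"
    using eq ij assms(1) by (auto simp: doubleton_eq_iff nth_eq_iff_index_eq)
  then show "i = j"
    using ij assms(2) by (auto simp: mod_Suc split: if_splits)
qed

text \<open>Each edge is traversed once, so summing along the list agrees with summing over the edge
  set.\<close>

lemma sum_cycle_edges:
  assumes "distinct vs" "length vs = l" "3 \<le> l"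
  shows "(\<Sum>i<l. Poly_Mapping.single {vs ! i, vs ! (Suc i mod l)} 1)
    = char_vec {{vs ! i, vs ! (Suc i mod l)} | i. i < l}"
proof -
  have "{{vs ! i, vs ! (Suc i mod l)} | i. i < l} = (\<lambda>i. {vs ! i, vs ! (Suc i mod l)}) ` {..<l}"
    by auto
  then show ?thesis
    using cycle_edges_inj[OF assms(1)] assms by (simp add: char_vec_def sum.reindex)
qed

text \<open>A node \<open>(f, u, S, v)\<close> stands for the walks from \<open>u\<close> to \<open>v\<close> whose vertices after \<open>u\<close>
  have distinct \<open>f\<close>-colours, forming the set \<open>S\<close>. As \<open>u\<close> is not counted in \<open>S\<close>, its colour stays available
  for the last step, which has to return to \<open>u\<close>; walks that used it earlier are dead ends.\<close>

type_synonym walk_node = "(nat \<Rightarrow> nat) \<times> nat \<times> nat set \<times> nat"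
type_synonym walk_arc = "(nat \<Rightarrow> nat) \<times> nat \<times> nat set \<times> nat \<times> nat"

definition arc_tail :: "walk_arc \<Rightarrow> walk_node" where
  "arc_tail = (\<lambda>(f, u, S, v, w). (f, u, S, v))"

definition arc_head :: "walk_arc \<Rightarrow> walk_node" where
  "arc_head = (\<lambda>(f, u, S, v, w). (f, u, insert (f w) S, w))"

definition node_rank :: "walk_node \<Rightarrow> nat" where
  "node_rank = (\<lambda>(f, u, S, v). card S)"

definition arc_edge :: "walk_arc \<Rightarrow> nat set" where
  "arc_edge = (\<lambda>(f, u, S, v, w). {v, w})"

text \<open>The arc for a step from \<open>v\<close> to \<open>w\<close>. The last two conditions
  make the walk start at \<open>u\<close> and return to \<open>u\<close> in step \<open>l\<close>.
  Since \<open>f\<close> and \<open>u\<close> are part of each node, different colourings and starts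
  never mix.\<close>

definition walk_arcs :: "nat \<Rightarrow> nat \<Rightarrow> (nat \<Rightarrow> nat) set \<Rightarrow> walk_arc set" where
  "walk_arcs n l G = {(f, u, S, v, w). f \<in> G \<and> u \<in> {1..n} \<and> S \<subseteq> {..<l} \<and> v \<in> {1..n} \<and> w \<in> {1..n} \<and>
     v \<noteq> w \<and> card S < l \<and> f w \<notin> S \<and> (S = {} \<longrightarrow> v = u) \<and> (Suc (card S) = l \<longrightarrow> w = u)}"

lemma walk_arcs_subset: "walk_arcs n l G \<subseteq> G \<times> {1..n} \<times> Pow {..<l} \<times> {1..n} \<times> {1..n}"
  by (auto simp: walk_arcs_def)

lemma finite_walk_arcs: "finite G \<Longrightarrow> finite (walk_arcs n l G)"
  by (rule finite_subset[OF walk_arcs_subset]) simp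

lemma card_walk_arcs:
  assumes "finite G"
  shows "card (walk_arcs n l G) \<le> card G * n ^ 3 * 2 ^ l"
proof -
  have "card (walk_arcs n l G) \<le> card (G \<times> {1..n} \<times> Pow {..<l} \<times> {1..n} \<times> {1..n})"
    using assms by (intro card_mono walk_arcs_subset) simp
  then show ?thesis by (simp add: card_cartesian_product card_Pow power3_eq_cube ac_simps)
qed

lemma walk_network:
  assumes "finite G" "0 < l"
  shows "layered_network (walk_arcs n l G) arc_tail arc_head node_rank l"
proof
  fix a assume "a \<in> walk_arcs n l G"
  then obtain f u S v w where a: "a = (f, u, S, v, w)" "S \<subseteq> {..<l}" "f w \<notin> S" "card S < l"
    by (auto simp: walk_arcs_def)
  then show "node_rank (arc_head a) = Suc (node_rank (arc_tail a))"
    using finite_subset[OF a(2)] by (simp add: arc_head_def arc_tail_def node_rank_def)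
  show "node_rank (arc_tail a) < l" using a by (simp add: arc_tail_def node_rank_def)
qed (use assms finite_walk_arcs in auto)

lemma walk_arcs_edge: "arc_edge ` walk_arcs n l G \<subseteq> complete_edges n"
  by (auto simp: walk_arcs_def arc_edge_def complete_edges_def)

section \<open>Network paths and rainbow cycles\<close>

text \<open>Along a path \<open>f\<close> and \<open>u\<close> stay fixed and the colour set records
  the heads passed so far. Hence the heads have distinct colours and are distinct vertices; the
  tails are the same vertices rotated by one, as the last head is \<open>u\<close>.\<close>

lemma walk_path_cycle:
  assumes "finite G" "3 \<le> l"
    and as: "as \<in> layered_network.paths (walk_arcs n l G) arc_tail arc_head node_rank l"
  shows "\<exists>vs. length vs = l \<and> distinct vs \<and> set vs \<subseteq> {1..n} \<and>
    (\<forall>i<l. arc_edge (as ! i) = {vs ! i, vs ! (Suc i mod l)})"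
proof -
  interpret layered_network "walk_arcs n l G" arc_tail arc_head node_rank l
    using assms by (intro walk_network) auto
  have len: "length as = l" and arcs: "\<And>k. k < l \<Longrightarrow> as ! k \<in> walk_arcs n l G"
    and ranks: "\<And>k. k < l \<Longrightarrow> node_rank (arc_tail (as ! k)) = k"
    and links: "\<And>k. Suc k < l \<Longrightarrow> arc_head (as ! k) = arc_tail (as ! Suc k)"
    using as by (auto simp: paths_def)
  define f u where "f = fst (as ! 0)" and "u = fst (snd (as ! 0))"
  define v w where "v k = fst (snd (snd (snd (as ! k))))" and "w k = snd (snd (snd (snd (as ! k))))" for k
  have arc: "as ! k = (f, u, f ` w ` {..<k}, v k, w k)" if "k < l" for k
    using that
  proof (induction k)
    case 0
    obtain S where S: "as ! 0 = (f, u, S, v 0, w 0)"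
      by (simp add: f_def u_def v_def w_def prod_eq_iff)
    \<comment> \<open>An infinite set also has \<open>card\<close> 0, so rank 0 gives
      \<open>S = {}\<close> only together with finiteness.\<close>
    moreover have "finite S" using arcs[OF 0] S by (auto simp: walk_arcs_def intro: finite_subset)
    ultimately show ?case using ranks[OF 0] by (simp add: arc_tail_def node_rank_def)
  next
    case (Suc k)
    obtain f' u' S where S: "as ! Suc k = (f', u', S, v (Suc k), w (Suc k))"
      by (simp add: v_def w_def prod_eq_iff)
    have "as ! k = (f, u, f ` w ` {..<k}, v k, w k)" using Suc by simp
    then show ?case
      using links[OF Suc.prems] S by (auto simp: arc_head_def arc_tail_def lessThan_Suc)
  qed
  have arc': "(f, u, f ` w ` {..<k}, v k, w k) \<in> walk_arcs n l G" if "k < l" for k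
    using arcs[OF that] arc[OF that] by simp
  have "f (w i) \<noteq> f (w j)" if "i < j" "j < l" for i j
  proof -
    have "f (w j) \<notin> f ` w ` {..<j}" using arc'[OF that(2)] by (simp add: walk_arcs_def)
    moreover have "f (w i) \<in> f ` w ` {..<j}" using that(1) by (intro imageI) simp
    ultimately show ?thesis by metis
  qed
  then have w_inj: "w i \<noteq> w j" if "i < j" "j < l" for i j using that by metis
  have v_Suc: "v (Suc k) = w k" if "Suc k < l" for k
    using links[OF that] arc[of k] arc[OF that] that by (simp add: arc_head_def arc_tail_def)
  have v_0: "v 0 = u" using arc'[of 0] assms(2) by (auto simp: walk_arcs_def)
  have w_last: "w (l - 1) = u"
  proof -
    \<comment> \<open>The return condition applies only once exactly \<open>l - 1\<close> colours
      are used.\<close>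
    have "card (f ` w ` {..<l - 1}) = l - 1"
      using ranks[of "l - 1"] arc[of "l - 1"] assms(2) by (simp add: arc_tail_def node_rank_def)
    then show ?thesis using arc'[of "l - 1"] assms(2) by (auto simp: walk_arcs_def)
  qed
  define vs where "vs = map v [0..<l]"
  have "v i \<noteq> v j" if "i < j" "j < l" for i j
  proof -
    have j: "v j = w (j - 1)" using v_Suc[of "j - 1"] that by simp
    show ?thesis
    proof (cases i)
      case 0
      have "j - 1 < l - 1" "l - 1 < l" using that by linarith+
      then show ?thesis using 0 j v_0 w_last w_inj[of "j - 1" "l - 1"] by simp
    next
      case (Suc i')
      then show ?thesis using j v_Suc[of i'] w_inj[of i' "j - 1"] that by simp
    qed
  qed
  then have "distinct vs" unfolding vs_def distinct_conv_nth
    by (auto simp: nat_neq_iff)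
  moreover have "set vs \<subseteq> {1..n}" using arc' by (auto simp: vs_def walk_arcs_def)
  moreover have "arc_edge (as ! i) = {vs ! i, vs ! (Suc i mod l)}" if "i < l" for i
  proof (cases "Suc i = l")
    case True
    then show ?thesis using arc[OF that] v_0 w_last that by (auto simp: arc_edge_def vs_def)
  next
    case False
    then show ?thesis using arc[OF that] v_Suc[of i] that by (simp add: arc_edge_def vs_def)
  qed
  ultimately show ?thesis by (intro exI[of _ vs]) (auto simp: vs_def)
qed

text \<open>The cycle is walked from its first vertex; injectivity of \<open>f\<close> on its
  vertices makes every colour new when it is reached.\<close>

lemma cycle_walk_path:
  assumes "finite G" "3 \<le> l" and f: "f \<in> G" "f \<in> {1..n} \<rightarrow> {..<l}" "inj_on f (set vs)"
    and vs: "length vs = l" "distinct vs" "set vs \<subseteq> {1..n}"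
  shows "\<exists>as \<in> layered_network.paths (walk_arcs n l G) arc_tail arc_head node_rank l.
    \<forall>i<l. arc_edge (as ! i) = {vs ! i, vs ! (Suc i mod l)}"
proof -
  interpret layered_network "walk_arcs n l G" arc_tail arc_head node_rank l
    using assms by (intro walk_network) auto
  \<comment> \<open>Indices start at 1: the colour of \<open>vs ! 0\<close> must still be free when
    the last step returns there.\<close>
  define S where "S k = (\<lambda>j. f (vs ! j)) ` {1..k}" for k
  define as where "as = map (\<lambda>k. (f, vs ! 0, S k, vs ! k, vs ! (Suc k mod l))) [0..<l]"
  have mem: "vs ! k \<in> {1..n}" if "k < l" for k using vs that by (metis nth_mem subsetD)
  have inj: "f (vs ! i) = f (vs ! j) \<longleftrightarrow> i = j" if "i < l" "j < l" for i j
    using f(3) vs that by (metis inj_on_eq_iff nth_eq_iff_index_eq nth_mem)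
  have card_S: "card (S k) = k" if "k < l" for k
    unfolding S_def using inj that by (subst card_image) (auto simp: inj_on_def)
  have S_sub: "S k \<subseteq> {..<l}" if "k < l" for k
    using f(2) mem that by (auto simp: S_def Pi_iff)
  have next_lt: "Suc k mod l < l" for k using assms(2) by (intro mod_less_divisor) linarith
  have "(f, vs ! 0, S k, vs ! k, vs ! (Suc k mod l)) \<in> walk_arcs n l G" if k: "k < l" for k
  proof -
    have "vs ! k \<noteq> vs ! (Suc k mod l)"
      using k vs next_lt[of k] assms(2) by (auto simp: nth_eq_iff_index_eq mod_Suc split: if_splits)
    moreover have "f (vs ! (Suc k mod l)) \<notin> S k"
    proof
      assume "f (vs ! (Suc k mod l)) \<in> S k"
      then obtain j where "j \<in> {1..k}" "f (vs ! (Suc k mod l)) = f (vs ! j)" by (auto simp: S_def)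
      then show False using inj[OF next_lt[of k], of j] k by (auto simp: mod_Suc split: if_splits)
    qed
    moreover have "S k = {} \<longrightarrow> vs ! k = vs ! 0" using card_S[OF k] by auto
    ultimately show ?thesis
      using k f(1) mem next_lt[of k] S_sub[OF k] card_S[OF k] assms(2)
      by (auto simp: walk_arcs_def dest!: mem)
  qed
  then have "set as \<subseteq> walk_arcs n l G" by (auto simp: as_def)
  moreover have "arc_head (as ! i) = arc_tail (as ! Suc i)" if "Suc i < l" for i
    using that by (simp add: as_def arc_head_def arc_tail_def S_def atLeastAtMostSuc_conv)
  moreover have "length as = l" "\<forall>i<l. node_rank (arc_tail (as ! i)) = i"
    using card_S by (auto simp: as_def arc_tail_def node_rank_def)
  ultimately have "as \<in> paths l" by (simp add: paths_def)
  moreover have "arc_edge (as ! i) = {vs ! i, vs ! (Suc i mod l)}" if "i < l" for i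
    using that by (simp add: as_def arc_edge_def)
  ultimately show ?thesis by blast
qed

text \<open>Every path traces a cycle; conversely the hash property supplies, for each cycle, a
  colouring that makes it rainbow.\<close>

lemma walk_paths_eq_simple_cycles:
  assumes G: "finite G" "G \<subseteq> {1..n} \<rightarrow>\<^sub>E {..<l}" and "3 \<le> l"
    and hash: "\<And>W. W \<subseteq> {1..n} \<Longrightarrow> card W = l \<Longrightarrow> \<exists>f\<in>G. inj_on f W"
  shows "(\<lambda>as. \<Sum>a\<leftarrow>as. Poly_Mapping.single (arc_edge a) (1::real)) `
      layered_network.paths (walk_arcs n l G) arc_tail arc_head node_rank l
    = char_vec ` simple_cycles l n"
    (is "?w ` ?P = _")
proof -
  interpret layered_network "walk_arcs n l G" arc_tail arc_head node_rank l
    using assms by (intro walk_network) auto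
  have weight: "?w as = char_vec {{vs ! i, vs ! (Suc i mod l)} | i. i < l}"
    if "as \<in> ?P" "length vs = l" "distinct vs"
      "\<forall>i<l. arc_edge (as ! i) = {vs ! i, vs ! (Suc i mod l)}" for as vs
  proof -
    have "?w as = (\<Sum>i<l. Poly_Mapping.single (arc_edge (as ! i)) 1)"
      using that(1) by (simp add: sum_list_sum_nth paths_def atLeast0LessThan)
    also have "\<dots> = (\<Sum>i<l. Poly_Mapping.single {vs ! i, vs ! (Suc i mod l)} 1)"
      using that(4) by simp
    finally show ?thesis unfolding sum_cycle_edges[OF that(3,2) assms(3)] .
  qed
  show ?thesis
  proof (intro equalityI subsetI)
    fix x assume "x \<in> ?w ` ?P"
    then obtain as where as: "as \<in> ?P" "x = ?w as" by auto
    obtain vs where vs: "length vs = l" "distinct vs" "set vs \<subseteq> {1..n}"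
        "\<forall>i<l. arc_edge (as ! i) = {vs ! i, vs ! (Suc i mod l)}"
      using walk_path_cycle[OF G(1) assms(3) as(1)] by blast
    then have "{{vs ! i, vs ! (Suc i mod l)} | i. i < l} \<in> simple_cycles l n"
      using assms(3) unfolding simple_cycles_def by blast
    then show "x \<in> char_vec ` simple_cycles l n"
      using weight[OF as(1) vs(1,2,4)] as(2) by blast
  next
    fix x assume "x \<in> char_vec ` simple_cycles l n"
    then obtain vs where vs: "length vs = l" "distinct vs" "set vs \<subseteq> {1..n}"
      and x: "x = char_vec {{vs ! i, vs ! (Suc i mod l)} | i. i < l}"
      unfolding simple_cycles_def by blast
    obtain f where f: "f \<in> G" "inj_on f (set vs)"
      using hash[OF vs(3)] distinct_card[OF vs(2)] vs(1) by auto
    then have "f \<in> {1..n} \<rightarrow> {..<l}" using G(2) by auto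
    then obtain as where as: "as \<in> ?P" "\<forall>i<l. arc_edge (as ! i) = {vs ! i, vs ! (Suc i mod l)}"
      using cycle_walk_path[OF G(1) assms(3) f(1) _ f(2) vs] by blast
    show "x \<in> ?w ` ?P"
      using weight[OF as(1) vs(1,2) as(2)] x as(1) by (intro image_eqI[of _ _ as]) simp_all
  qed
qed

section \<open>Size bounds\<close>

text \<open>The number \<open>d\<close> is the arc count of the network, kept explicit because it
  controls both the size and the encoding length.\<close>

lemma cycle_polytope_extended_formulation:
  assumes "1 \<le> n" and q: "exp (real l) * real l * ln (real n) < real q"
  shows "\<exists>F. is_extended_formulation F (complete_edges n) (cycle_polytope l n) \<and>
     (\<exists>d. ef_size F = d \<and> d \<le> q * n ^ 3 * 2 ^ l \<and>
        ef_encoding_length F (complete_edges n) \<le> (3 * d + 1 + card (complete_edges n)) * (3 * (d + 1)))"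
proof (cases "3 \<le> l")
  case True
  obtain G where G: "G \<subseteq> {1..n} \<rightarrow>\<^sub>E {..<l}" "finite G" "card G \<le> q"
    and hash: "\<And>W. W \<subseteq> {1..n} \<Longrightarrow> card W = l \<Longrightarrow> \<exists>f\<in>G. inj_on f W"
    using perfect_hash_family[of l n q] assms True by auto
  interpret layered_network "walk_arcs n l G" arc_tail arc_head node_rank l
    using G True by (intro walk_network) auto
  have paths: "(\<lambda>as. \<Sum>a\<leftarrow>as. Poly_Mapping.single (arc_edge a) (1::real)) ` paths l
      = char_vec ` simple_cycles l n"
    using G True hash by (intro walk_paths_eq_simple_cycles)
  have "finite (complete_edges n)" by (simp add: complete_edges_def)
  from network_extended_formulation[OF walk_arcs_edge this]
  obtain F where "is_extended_formulation F (complete_edges n) (cycle_polytope l n)"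
    "ef_size F = card (walk_arcs n l G)" "ef_encoding_length F (complete_edges n)
      \<le> (3 * card (walk_arcs n l G) + 1 + card (complete_edges n)) * (3 * (card (walk_arcs n l G) + 1))"
    unfolding paths cycle_polytope_def by blast
  moreover have "card (walk_arcs n l G) \<le> q * n ^ 3 * 2 ^ l"
    by (rule order_trans[OF card_walk_arcs[OF G(2)]]) (intro mult_right_mono G(3), auto)
  ultimately show ?thesis by blast
next
  case False
  \<comment> \<open>For \<open>l < 3\<close> the polytope is empty; so is the flow polyhedron of a
    network without arcs, whose source equation reads \<open>0 = 1\<close>.\<close>
  interpret layered_network "{} :: walk_arc set" arc_tail arc_head node_rank 1
    by unfold_locales auto
  have "paths 1 = {}" by (auto simp: paths_def)
  moreover have "cycle_polytope l n = {}" using False by (simp add: cycle_polytope_def simple_cycles_def)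
  moreover have "finite (complete_edges n)" by (simp add: complete_edges_def)
  ultimately show ?thesis using network_extended_formulation[of arc_edge "complete_edges n"] by auto
qed

section \<open>Polynomial bounds in the number of edges\<close>

lemma card_complete_edges: "2 * card (complete_edges n) = n * (n - 1)"
proof -
  have "card (complete_edges n) = n choose 2"
    using n_subsets[of "{1..n}" 2] by (simp add: complete_edges_def)
  moreover have "even (n * (n - 1))" by (cases n) auto
  ultimately show ?thesis by (simp add: choose_two)
qed

text \<open>Turns polynomial bounds in \<open>n\<close> into polynomial bounds in the dimension of
  the ambient space.\<close>

lemma le_twice_card_complete_edges:
  assumes "2 \<le> n"
  shows "n \<le> 2 * card (complete_edges n)"
  using assms by (simp add: card_complete_edges)

text \<open>Each of \<open>exp l\<close>, \<open>l\<close> and \<open>2 ^ l\<close> is at most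
  \<open>n ^ C\<close>. With \<open>ln n \<le> n\<close> this gives
  \<open>q \<le> 2 * n ^ (2 * C + 1)\<close>, and the factors \<open>n ^ 3\<close> and
  \<open>2 ^ l\<close> raise the exponent to \<open>3 * C + 4\<close>.\<close>

lemma size_estimate:
  assumes C: "c \<le> real C" and n: "2 \<le> n" and l: "real l \<le> c * ln (real n)"
  defines "q \<equiv> Suc (nat \<lfloor>exp (real l) * real l * ln (real n)\<rfloor>)"
  shows "real (q * n ^ 3 * 2 ^ l) \<le> 2 * real n ^ (3 * C + 4)"
proof -
  have ln: "0 \<le> ln (real n)" "ln (real n) \<le> real n"
    using n ln_le_minus_one[of "real n"] by auto
  have "real l \<le> real C * ln (real n)"
    using l mult_right_mono[OF C ln(1)] by linarith
  then have "exp (real l) \<le> exp (real C * ln (real n))" by simp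
  then have exp_le: "exp (real l) \<le> real n ^ C" using n by (simp add: exp_of_nat_mult)
  have l_le: "real l \<le> real n ^ C" using exp_le exp_ge_add_one_self[of "real l"] by linarith
  have "(2::real) ^ l \<le> exp 1 ^ l"
    using exp_ge_add_one_self[of 1] by (intro power_mono) auto
  then have two: "2 ^ l \<le> real n ^ C"
    using exp_le by (simp flip: exp_of_nat_mult)
  have "real q \<le> exp (real l) * real l * ln (real n) + 1"
    using ln by (simp add: q_def)
  also have "\<dots> \<le> real n ^ C * real n ^ C * real n + 1"
    using exp_le l_le ln by (intro add_right_mono mult_mono) auto
  also have "\<dots> \<le> 2 * real n ^ (2 * C + 1)"
  proof -
    have "real n ^ C * real n ^ C * real n = real n ^ (2 * C + 1)" by (simp add: power_add mult_2)
    then show ?thesis using n one_le_power[of "real n" "2 * C + 1"] by simp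
  qed
  finally have q: "real q \<le> 2 * real n ^ (2 * C + 1)" .
  have "real (q * n ^ 3 * 2 ^ l) = real q * real n ^ 3 * 2 ^ l" by simp
  also have "\<dots> \<le> 2 * real n ^ (2 * C + 1) * real n ^ 3 * real n ^ C"
    using q two by (intro mult_mono) auto
  also have "\<dots> = 2 * real n ^ (3 * C + 4)"
  proof -
    have "3 * C + 4 = 2 * C + 1 + 3 + C" by simp
    then show ?thesis by (simp only: power_add mult.assoc)
  qed
  finally show ?thesis .
qed

theorem corollary29:
  fixes c :: real
  assumes "c > 0"
  shows "has_compact_extended_formulations
           {(l, n). 1 \<le> l \<and> 1 \<le> n \<and> real l \<le> c * ln (real n)}
           (\<lambda>(l, n). complete_edges n)
           (\<lambda>(l, n). cycle_polytope l n)"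
proof -
  obtain C :: nat where C: "c \<le> real C" using real_arch_simple by blast
  define D where "D = 3 * C + 4"
  \<comment> \<open>From \<open>n \<le> 2 * m\<close>: the size bound \<open>2 * n ^ D\<close> is at
    most \<open>2 * (2 * m) ^ D = K * m ^ D\<close>.\<close>
  define K :: real where "K = 2 * 2 ^ D"
  \<comment> \<open>The product of the bounds \<open>(3 * K + 2) * m ^ D\<close> and
    \<open>3 * (K + 1) * m ^ D\<close> for the two factors of the encoding length.\<close>
  define p where "p = monom ((3 * K + 2) * (3 * (K + 1))) (2 * D)"
  have "\<exists>F. is_extended_formulation F (complete_edges n) (cycle_polytope l n) \<and>
      real (ef_size F) \<le> poly p (real (card (complete_edges n))) \<and>
      real (ef_encoding_length F (complete_edges n)) \<le> poly p (real (card (complete_edges n)))"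
    if l: "1 \<le> l" and n: "1 \<le> n" and ln: "real l \<le> c * ln (real n)" for l n
  proof -
    \<comment> \<open>One more than the floor, as the hash family asks for a strict
      inequality.\<close>
    define q where "q = Suc (nat \<lfloor>exp (real l) * real l * ln (real n)\<rfloor>)"
    define m where "m = real (card (complete_edges n))"
    \<comment> \<open>For \<open>n = 1\<close> the logarithm vanishes, contradicting
      \<open>1 \<le> l\<close>.\<close>
    have n2: "2 \<le> n" using l n ln by (cases "n = 1") auto
    have m: "real n \<le> 2 * m" "1 \<le> m"
      using le_twice_card_complete_edges[OF n2] n2 by (auto simp: m_def simp flip: of_nat_mult)
    have "exp (real l) * real l * ln (real n) < real q" unfolding q_def by linarith
    then obtain F d where F: "is_extended_formulation F (complete_edges n) (cycle_polytope l n)"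
      and d: "ef_size F = d" "d \<le> q * n ^ 3 * 2 ^ l"
      and enc: "ef_encoding_length F (complete_edges n)
        \<le> (3 * d + 1 + card (complete_edges n)) * (3 * (d + 1))"
      using cycle_polytope_extended_formulation[OF n, of l q] by blast
    have "real d \<le> real (q * n ^ 3 * 2 ^ l)" using d(2) of_nat_le_iff by blast
    also have "\<dots> \<le> 2 * real n ^ D" unfolding q_def D_def by (rule size_estimate[OF C n2 ln])
    also have "\<dots> \<le> 2 * (2 * m) ^ D" using m by (intro mult_left_mono power_mono) auto
    finally have dK: "real d \<le> K * m ^ D" by (simp add: K_def power_mult_distrib)
    have D: "m \<le> m ^ D" "1 \<le> m ^ D"
      using m power_increasing[of 1 D m] by (auto simp: D_def)
    have "(3 * real d + 1 + m) * (3 * (real d + 1)) \<le> ((3 * K + 2) * m ^ D) * (3 * ((K + 1) * m ^ D))"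
    proof (rule mult_mono)
      show "3 * real d + 1 + m \<le> (3 * K + 2) * m ^ D"
        using dK D by (simp add: distrib_right)
      show "3 * (real d + 1) \<le> 3 * ((K + 1) * m ^ D)"
        using dK D by (simp add: distrib_right)
      show "0 \<le> (3 * K + 2) * m ^ D" using D by (simp add: K_def)
    qed simp
    also have "\<dots> = poly p m"
    proof -
      have "m ^ (2 * D) = m ^ D * m ^ D" by (simp add: mult_2 power_add)
      then show ?thesis by (simp add: p_def poly_monom)
    qed
    finally have bound: "(3 * real d + 1 + m) * (3 * (real d + 1)) \<le> poly p m" .
    have "real (ef_encoding_length F (complete_edges n)) \<le> (3 * real d + 1 + m) * (3 * (real d + 1))"
      using of_nat_mono[OF enc, where 'a = real] by (simp add: m_def algebra_simps)
    moreover have "real d * 1 \<le> (3 * real d + 1 + m) * (3 * (real d + 1))"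
      using m by (intro mult_mono) auto
    ultimately show ?thesis using F d bound unfolding m_def by (intro exI[of _ F]) simp
  qed
  \<comment> \<open>The polynomial is constant in the vertex encoding length: the number of edges
    alone bounds everything.\<close>
  then show ?thesis
    unfolding has_compact_extended_formulations_def by (intro exI[of _ "[:p:]"]) (auto simp: Let_def)
qed

end
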